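(* Let $q$ be a prime power, $F=\mathrm{GF}(q)$, $m\ge 2$ an integer and $n=\frac{q^m-1}{q-1}$. Let $\mathfrak{A}\subset F^m$ be the set of nonzero vectors whose first nonzero entry equals $1$ (so $|\mathfrak{A}|=n$), and index the coordinates of $F^n$ by $\mathfrak{A}$, the first $m$ coordinates being indexed by $\pi^{(1)}=(1,0,\ldots,0),\ldots,\pi^{(m)}=(0,\ldots,0,1)$ and the remaining $n-m$ coordinates in some fixed order. Let $\mathcal H_m=\{\bar c\in F^n \mid \sum_{\alpha\in\mathfrak{A}} c_\alpha\alpha=0^m\}$ be the Hamming code. For $\delta\in\mathfrak{A}$ let $\bar e^{(\delta)}\in F^n$ be the unit vector with $1$ in coordinate $\delta$, let $T_\delta=\{\bar c\in\mathcal H_m \mid |\{\alpha: c_\alpha\neq 0\}|=3,\ c_\delta=1\}$, and let $R_\delta$ be the linear span of $T_\delta$. For $\alpha=(\alpha_1,\ldots,\alpha_m)\in F^m$ let $\bar\alpha=(\alpha,0^{n-m})=\sum_{i=1}^m\alpha_i\bar e^{(\pi^{(i)})}\in F^n$. Let $C\subset F^{m-1}$ be a $1$-code and set $\dot C=\{(1,x)\mid x\in C\}\subset\mathfrak{A}$. Then the set $$P(C)=\Bigl(\mathcal H_m\setminus\bigcup_{\delta\in\dot C}(R_\delta+\bar\delta-\bar e^{(\delta)})\Bigr)\cup\Bigl(\bigcup_{\delta\in\dot C}(R_\delta+\bar\delta)\Bigr)$$ is a $1$-perfect code in $F^n$, and $$C=\{x\in F^{m-1}\mid (1,x,0^{n-m})\in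 P(C)\}.$$
   Context: The Hamming distance between two vectors of the same length is the number of positions where they differ. The neighborhood $\Omega(M)$ of a set $M\subset F^N$ is the set of vectors at distance at most $1$ from some element of $M$. A set $C\subset F^N$ is a $1$-code if the neighborhoods of its elements are pairwise disjoint. A $1$-code $P\subset F^N$ is $1$-perfect if $\Omega(P)=F^N$. *)

theory Defs
  imports Complex_Main "HOL-Library.Function_Algebras" "HOL-Library.FuncSet" "HOL-Library.Cardinality"
begin

text \<open>
  The space \<open>F^I\<close> of vectors over the field \<open>'a\<close> with coordinates indexed by a set \<open>I\<close>:
  functions that vanish outside \<open>I\<close>, so that pointwise operations on functions are the vector
  operations. The index set is \<open>{..<m}\<close> for \<open>F^m\<close> (coordinates are counted from 0),
  \<open>{..<m - 1}\<close> for \<open>F^(m - 1)\<close>, and \<open>normalized m\<close> (below) for \<open>F^n\<close>.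
\<close>

definition vecs :: "'i set \<Rightarrow> ('i \<Rightarrow> 'a::zero) set" where
  "vecs I = {x. \<forall>i. i \<notin> I \<longrightarrow> x i = 0}"

definition scale :: "'a::times \<Rightarrow> ('i \<Rightarrow> 'a) \<Rightarrow> ('i \<Rightarrow> 'a)" where
  "scale a x = (\<lambda>i. a * x i)"

definition unit_vec :: "'i \<Rightarrow> ('i \<Rightarrow> 'a::zero_neq_one)" where
  "unit_vec j = (\<lambda>i. if i = j then 1 else 0)"

lemma vector_space_scale: "vector_space (scale :: 'a::field \<Rightarrow> ('i \<Rightarrow> 'a) \<Rightarrow> ('i \<Rightarrow> 'a))"
  by standard (auto simp: scale_def fun_eq_iff algebra_simps)


section \<open>Perfect codes\<close>

definition hamming_dist :: "'i set \<Rightarrow> ('i \<Rightarrow> 'a) \<Rightarrow> ('i \<Rightarrow> 'a) \<Rightarrow> nat" where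
  "hamming_dist I x y = card {i \<in> I. x i \<noteq> y i}"

definition neighborhood :: "'i set \<Rightarrow> ('i \<Rightarrow> 'a::zero) set \<Rightarrow> ('i \<Rightarrow> 'a) set" where
  "neighborhood I M = {y \<in> vecs I. \<exists>x\<in>M. hamming_dist I x y \<le> 1}"

definition one_code :: "'i set \<Rightarrow> ('i \<Rightarrow> 'a::zero) set \<Rightarrow> bool" where
  "one_code I C \<longleftrightarrow> C \<subseteq> vecs I \<and>
     (\<forall>x\<in>C. \<forall>y\<in>C. x \<noteq> y \<longrightarrow> neighborhood I {x} \<inter> neighborhood I {y} = {})"

definition one_perfect :: "'i set \<Rightarrow> ('i \<Rightarrow> 'a::zero) set \<Rightarrow> bool" where
  "one_perfect I P \<longleftrightarrow> one_code I P \<and> neighborhood I P = vecs I"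


section \<open>The Hamming code and its switchings\<close>

definition normalized :: "nat \<Rightarrow> (nat \<Rightarrow> 'a::field) set" where
  "normalized m = {\<alpha> \<in> vecs {..<m}. \<alpha> \<noteq> 0 \<and> \<alpha> (LEAST i. \<alpha> i \<noteq> 0) = 1}"

definition hamming_code :: "nat \<Rightarrow> ((nat \<Rightarrow> 'a::field) \<Rightarrow> 'a) set" where
  "hamming_code m = {c \<in> vecs (normalized m). (\<Sum>\<alpha>\<in>normalized m. scale (c \<alpha>) \<alpha>) = 0}"

definition triples :: "nat \<Rightarrow> (nat \<Rightarrow> 'a::field) \<Rightarrow> ((nat \<Rightarrow> 'a) \<Rightarrow> 'a) set" where
  "triples m \<delta> =
     {c \<in> hamming_code m. card {\<alpha> \<in> normalized m. c \<alpha> \<noteq> 0} = 3 \<and> c \<delta> = 1}"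

definition linear_component :: "nat \<Rightarrow> (nat \<Rightarrow> 'a::field) \<Rightarrow> ((nat \<Rightarrow> 'a) \<Rightarrow> 'a) set" where
  "linear_component m \<delta> = module.span scale (triples m \<delta>)"

text \<open>
  The padding \<open>(\<alpha>, 0^(n - m))\<close>. The first \<open>m\<close> coordinates of \<open>F^n\<close> are those indexed by the
  unit vectors of \<open>F^m\<close>; the order of the remaining ones plays no role.
\<close>

definition pad :: "nat \<Rightarrow> (nat \<Rightarrow> 'a::field) \<Rightarrow> ((nat \<Rightarrow> 'a) \<Rightarrow> 'a)" where
  "pad m \<alpha> = (\<Sum>i<m. scale (\<alpha> i) (unit_vec (unit_vec i)))"

text \<open>The vector \<open>(1, x)\<close> for \<open>x\<close> in \<open>F^(m - 1)\<close>.\<close>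

definition prepend_one :: "(nat \<Rightarrow> 'a::one) \<Rightarrow> (nat \<Rightarrow> 'a)" where
  "prepend_one x = case_nat 1 x"

definition switched_code :: "nat \<Rightarrow> (nat \<Rightarrow> 'a::field) set \<Rightarrow> ((nat \<Rightarrow> 'a) \<Rightarrow> 'a) set" where
  "switched_code m C =
     (hamming_code m -
        (\<Union>\<delta>\<in>prepend_one ` C. (\<lambda>r. r + pad m \<delta> - unit_vec \<delta>) ` linear_component m \<delta>)) \<union>
     (\<Union>\<delta>\<in>prepend_one ` C. (\<lambda>r. r + pad m \<delta>) ` linear_component m \<delta>)"


section \<open>Basic facts about the coordinates\<close>

lemma bij_betw_vecs_PiE:
  "bij_betw (\<lambda>x. restrict x I) (vecs I :: ('i \<Rightarrow> 'a::zero) set) (I \<rightarrow>\<^sub>E UNIV)"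
proof (rule bij_betwI[where g = "\<lambda>f i. if i \<in> I then f i else 0"])
  show "(\<lambda>x. restrict x I) \<in> (vecs I :: ('i \<Rightarrow> 'a) set) \<rightarrow> (I \<rightarrow>\<^sub>E UNIV)"
    by auto
  show "(\<lambda>f i. if i \<in> I then f i else 0) \<in> (I \<rightarrow>\<^sub>E UNIV) \<rightarrow> (vecs I :: ('i \<Rightarrow> 'a) set)"
    by (auto simp: vecs_def)
  show "(\<lambda>i. if i \<in> I then restrict x I i else 0) = x" if "x \<in> vecs I" for x :: "'i \<Rightarrow> 'a"
    using that by (auto simp: vecs_def fun_eq_iff)
  show "restrict (\<lambda>i. if i \<in> I then f i else (0::'a)) I = f" if "f \<in> I \<rightarrow>\<^sub>E UNIV" for f
    using that by (auto simp: fun_eq_iff PiE_def extensional_def)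
qed

lemma finite_vecs: "finite I \<Longrightarrow> finite (vecs I :: ('i \<Rightarrow> 'a::{zero,finite}) set)"
  using bij_betw_finite[OF bij_betw_vecs_PiE] finite_PiE[of I "\<lambda>_. UNIV :: 'a set"] by auto

lemma card_vecs:
  "finite I \<Longrightarrow> card (vecs I :: ('i \<Rightarrow> 'a::{zero,finite}) set) = CARD('a) ^ card I"
  using bij_betw_same_card[OF bij_betw_vecs_PiE[of I, where 'a = 'a]]
  by (simp add: card_PiE)

lemma finite_normalized: "finite (normalized m :: (nat \<Rightarrow> 'a::{field,finite}) set)"
  by (rule finite_subset[OF _ finite_vecs[of "{..<m}"]]) (auto simp: normalized_def)

lemma bij_betw_normalized:
  "bij_betw (\<lambda>(a, \<alpha>). scale a \<alpha>) ((UNIV - {0}) \<times> normalized m)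
     (vecs {..<m} - {0} :: (nat \<Rightarrow> 'a::field) set)"
proof (rule bij_betwI[where g = "\<lambda>x. (x (LEAST i. x i \<noteq> 0),
    scale (inverse (x (LEAST i. x i \<noteq> 0))) x)"])
  have *: "(LEAST i. scale a x i \<noteq> 0) = (LEAST i. x i \<noteq> 0)" if "a \<noteq> 0" for a and x :: "nat \<Rightarrow> 'a"
    using that by (simp add: scale_def)
  have **: "x (LEAST i. x i \<noteq> 0) \<noteq> 0" if "x \<noteq> 0" for x :: "nat \<Rightarrow> 'a"
    using that LeastI_ex[of "\<lambda>i. x i \<noteq> 0"] by (auto simp: fun_eq_iff)
  have nz: "scale a x \<noteq> 0" if "a \<noteq> 0" "x \<noteq> 0" for a and x :: "nat \<Rightarrow> 'a"
    using that by (auto simp: scale_def fun_eq_iff)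
  have in_vecs: "scale a x \<in> vecs I" if "x \<in> vecs I" for a I and x :: "nat \<Rightarrow> 'a"
    using that by (auto simp: scale_def vecs_def)
  show "(\<lambda>(a, \<alpha>). scale a \<alpha>) \<in>
      (UNIV - {0}) \<times> normalized m \<rightarrow> (vecs {..<m} - {0} :: (nat \<Rightarrow> 'a) set)"
    using nz in_vecs by (auto simp: normalized_def)
  show "(\<lambda>x. (x (LEAST i. x i \<noteq> 0), scale (inverse (x (LEAST i. x i \<noteq> 0))) x))
      \<in> (vecs {..<m} - {0} :: (nat \<Rightarrow> 'a) set) \<rightarrow> (UNIV - {0}) \<times> normalized m"
  proof (rule Pi_I)
    fix x :: "nat \<Rightarrow> 'a" assume x: "x \<in> vecs {..<m} - {0}"
    let ?b = "x (LEAST i. x i \<noteq> 0)"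
    have b: "?b \<noteq> 0" using ** x by blast
    have "scale (inverse ?b) x (LEAST i. scale (inverse ?b) x i \<noteq> 0) = inverse ?b * ?b"
      using *[of "inverse ?b" x] b by (simp add: scale_def)
    then have "scale (inverse ?b) x (LEAST i. scale (inverse ?b) x i \<noteq> 0) = 1"
      using b by simp
    then show "(?b, scale (inverse ?b) x) \<in> (UNIV - {0}) \<times> normalized m"
      using b x nz[of "inverse ?b" x] in_vecs[of x "{..<m}" "inverse ?b"]
      by (simp add: normalized_def)
  qed
  show "(\<lambda>x. (x (LEAST i. x i \<noteq> 0), scale (inverse (x (LEAST i. x i \<noteq> 0))) x))
      ((\<lambda>(a, \<alpha>). scale a \<alpha>) p) = p"
    if p_in: "p \<in> (UNIV - {0}) \<times> normalized m" for p :: "'a \<times> (nat \<Rightarrow> 'a)"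
  proof -
    obtain a \<alpha> where p: "p = (a, \<alpha>)" "a \<noteq> 0" "\<alpha> (LEAST i. \<alpha> i \<noteq> 0) = 1"
      using p_in by (cases p) (auto simp: normalized_def)
    have "scale a \<alpha> (LEAST i. scale a \<alpha> i \<noteq> 0) = a"
      unfolding *[OF p(2)] using p(3) by (simp add: scale_def)
    moreover have "scale (inverse a) (scale a \<alpha>) = \<alpha>"
      using p(2) by (simp add: scale_def mult.assoc[symmetric])
    ultimately show ?thesis using p(1) by simp
  qed
  show "(\<lambda>(a, \<alpha>). scale a \<alpha>) (x (LEAST i. x i \<noteq> 0),
      scale (inverse (x (LEAST i. x i \<noteq> 0))) x) = x" if "x \<in> vecs {..<m} - {0}" for x :: "nat \<Rightarrow> 'a"
    using **[of x] that by (simp add: scale_def mult.assoc[symmetric])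
qed

lemma card_normalized:
  "card (normalized m :: (nat \<Rightarrow> 'a::{field,finite}) set)
     = (CARD('a) ^ m - 1) div (CARD('a) - 1)"
proof -
  have "(CARD('a) - 1) * card (normalized m :: (nat \<Rightarrow> 'a) set) = CARD('a) ^ m - 1"
    using bij_betw_same_card[OF bij_betw_normalized[of m, where 'a = 'a]]
      card_vecs[of "{..<m}", where 'a = 'a] finite_vecs[of "{..<m}", where 'a = 'a]
    by (simp add: card_cartesian_product card_Diff_singleton vecs_def)
  moreover have "CARD('a) > 1"
    using card_mono[of UNIV "{0, 1 :: 'a}"] by simp
  ultimately show ?thesis
    by (metis nonzero_mult_div_cancel_left zero_less_diff less_irrefl_nat)
qed

lemma unit_vec_in_normalized: "i < m \<Longrightarrow> (unit_vec i :: nat \<Rightarrow> 'a::field) \<in> normalized m"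
  by (auto simp: normalized_def vecs_def unit_vec_def fun_eq_iff intro: LeastI2)

lemma pad_unit_vec:
  fixes \<alpha> :: "nat \<Rightarrow> 'a::field"
  assumes "i < m"
  shows "pad m \<alpha> (unit_vec i) = \<alpha> i"
proof -
  have sum_apply: "(\<Sum>j\<in>J. f j) x = (\<Sum>j\<in>J. f j x)"
    if "finite J" for f :: "nat \<Rightarrow> (nat \<Rightarrow> 'a) \<Rightarrow> 'a" and J x
    using that by (induction J) auto
  have "(unit_vec i :: nat \<Rightarrow> 'a) = unit_vec j \<longleftrightarrow> i = j" for j
    by (auto simp: unit_vec_def fun_eq_iff)
  then have "pad m \<alpha> (unit_vec i) = (\<Sum>j<m. if i = j then \<alpha> j else 0)"
    unfolding pad_def sum_apply[OF finite_lessThan]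
    by (intro sum.cong) (auto simp: scale_def unit_vec_def[of "unit_vec _"])
  then show ?thesis using assms by simp
qed

lemma prepend_one_in_normalized:
  assumes "m \<ge> 1" "x \<in> vecs {..<m - 1}"
  shows "prepend_one x \<in> normalized m"
proof -
  have "prepend_one x i = 0" if "i \<notin> {..<m}" for i
    using assms that by (cases i) (auto simp: prepend_one_def vecs_def)
  moreover have "prepend_one x 0 = 1"
    by (simp add: prepend_one_def)
  moreover from this have "(LEAST i. prepend_one x i \<noteq> 0) = 0"
    by (intro Least_equality) auto
  moreover have "prepend_one x \<noteq> 0"
    by (metis calculation(2) zero_fun_apply zero_neq_one)
  ultimately show ?thesis
    by (simp add: normalized_def vecs_def)
qed

end

theory Submission
  imports Defs
begin

text \<open>
  The Hamming code \<open>H\<close> is perfect, and exchanging the subset \<open>K = R\<^sub>\<delta> + \<delta>\<^sup>- - e\<^sub>\<delta>\<close> for its translate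
  \<open>K + e\<^sub>\<delta>\<close> does not change the neighborhood: in \<open>k + b e\<^sub>\<beta>\<close> the error \<open>b e\<^sub>\<beta>\<close> can be moved to
  another point of the line through \<open>\<beta>\<close> and \<open>\<delta>\<close> by adding \<open>e\<^sub>\<delta>\<close> and a triple of \<open>T\<^sub>\<delta>\<close>. Hence all the
  switchings can be done simultaneously as soon as the exchanged subsets are disjoint. If those
  of \<open>\<delta>\<close> and \<open>\<delta>'\<close> met, then \<open>\<delta>\<^sup>- - e\<^sub>\<delta> - \<delta>'\<^sup>- + e\<^sub>\<delta>\<^sub>'\<close> would lie in \<open>R\<^sub>\<delta> + R\<^sub>\<delta>\<^sub>'\<close>. For a subspace \<open>S\<close>
  that contains \<open>L = \<langle>\<delta>, \<delta>'\<rangle>\<close>, a triple of \<open>T\<^sub>\<delta>\<close> or \<open>T\<^sub>\<delta>\<^sub>'\<close> is either contained in \<open>S\<close> or meets it in a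
  single point of \<open>L\<close>, so the syndrome restricted to the coordinates in \<open>S\<close> of any word of
  \<open>R\<^sub>\<delta> + R\<^sub>\<delta>\<^sub>'\<close> lies in \<open>L\<close>. For \<open>S = \<langle>\<delta>, \<delta>', \<pi>\<^sub>i\<rangle>\<close> with \<open>\<delta>\<^sub>i \<noteq> \<delta>'\<^sub>i\<close> this fails, because \<open>\<delta> - \<delta>'\<close> has
  weight at least 3.
\<close>

interpretation vs: vector_space "scale :: 'a::field \<Rightarrow> ('i \<Rightarrow> 'a) \<Rightarrow> ('i \<Rightarrow> 'a)"
  by (rule vector_space_scale)

section \<open>Neighborhoods and switching\<close>

lemma vecs_subspace: "vs.subspace (vecs I)"
  by (auto simp: vs.subspace_def vecs_def scale_def)

lemma unit_vec_in_vecs: "j \<in> I \<Longrightarrow> unit_vec j \<in> vecs I"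
  by (auto simp: vecs_def unit_vec_def)

lemmas vecs_intros = vs.subspace_0[OF vecs_subspace] vs.subspace_add[OF vecs_subspace]
  vs.subspace_diff[OF vecs_subspace] vs.subspace_scale[OF vecs_subspace] unit_vec_in_vecs

text \<open>Equality of \<open>x\<close> and \<open>y\<close> is the case \<open>b = 0\<close>; a
  coordinate \<open>j\<close> must be named even then, which is where \<open>I\<close> being
  nonempty enters.\<close>

lemma hamming_dist_le_1_iff:
  fixes x y :: "'i \<Rightarrow> 'a::field"
  assumes "finite I" "I \<noteq> {}" "x \<in> vecs I" "y \<in> vecs I"
  shows "hamming_dist I x y \<le> 1 \<longleftrightarrow> (\<exists>j\<in>I. \<exists>b. y = x + scale b (unit_vec j))"
proof
  assume "hamming_dist I x y \<le> 1"
  then have *: "\<forall>i\<in>{i \<in> I. x i \<noteq> y i}. \<forall>j\<in>{i \<in> I. x i \<noteq> y i}. i = j"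
    using assms(1) card_le_Suc0_iff_eq[of "{i \<in> I. x i \<noteq> y i}"] by (simp add: hamming_dist_def)
  obtain j where j: "j \<in> I" "{i \<in> I. x i \<noteq> y i} \<subseteq> {j}"
  proof (cases "{i \<in> I. x i \<noteq> y i} = {}")
    case True
    then show ?thesis using assms(2) that by fastforce
  next
    case False
    then show ?thesis using * that by blast
  qed
  have "x k = y k" if "k \<noteq> j" for k
    using j that assms(3,4) by (cases "k \<in> I") (auto simp: vecs_def)
  then have "y = x + scale (y j - x j) (unit_vec j)"
    by (auto simp: fun_eq_iff scale_def unit_vec_def)
  with j show "\<exists>j\<in>I. \<exists>b. y = x + scale b (unit_vec j)" by blast
next
  assume "\<exists>j\<in>I. \<exists>b. y = x + scale b (unit_vec j)"
  then obtain j b where "y = x + scale b (unit_vec j)" by blast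
  then have "{i \<in> I. x i \<noteq> y i} \<subseteq> {j}"
    by (auto simp: scale_def unit_vec_def split: if_splits)
  from card_mono[OF _ this] show "hamming_dist I x y \<le> 1"
    by (simp add: hamming_dist_def)
qed

text \<open>Additive form of the neighborhood, a codeword plus a single error, to which linear maps
  such as the syndrome can be applied.\<close>

lemma neighborhood_eq:
  fixes M :: "('i \<Rightarrow> 'a::field) set"
  assumes "finite I" "I \<noteq> {}" "M \<subseteq> vecs I"
  shows "neighborhood I M = {x + scale b (unit_vec j) | x b j. x \<in> M \<and> j \<in> I}"
proof -
  have "x + scale b (unit_vec j) \<in> vecs I" if "x \<in> M" "j \<in> I" for x b j
    using that assms(3) by (auto intro!: vecs_intros)
  moreover have "hamming_dist I x y \<le> 1 \<longleftrightarrow> (\<exists>j\<in>I. \<exists>b. y = x + scale b (unit_vec j))"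
    if "x \<in> M" "y \<in> vecs I" for x y
    using hamming_dist_le_1_iff[OF assms(1,2)] that assms(3) by blast
  ultimately show ?thesis unfolding neighborhood_def by blast
qed

lemma neighborhood_UN: "neighborhood I M = (\<Union>x\<in>M. neighborhood I {x})"
  by (auto simp: neighborhood_def)

lemma neighborhood_translate:
  fixes t :: "'i \<Rightarrow> 'a::field"
  assumes "t \<in> vecs I"
  shows "neighborhood I {x + t} = (\<lambda>y. y + t) ` neighborhood I {x}"
proof (intro equalityI subsetI)
  fix y assume "y \<in> neighborhood I {x + t}"
  then have "y - t \<in> neighborhood I {x}"
    using assms by (auto simp: neighborhood_def hamming_dist_def eq_diff_eq intro!: vecs_intros)
  then show "y \<in> (\<lambda>y. y + t) ` neighborhood I {x}"
    by (intro image_eqI[of _ _ "y - t"]) auto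
qed (use assms in \<open>auto simp: neighborhood_def hamming_dist_def intro!: vecs_intros\<close>)

lemma mem_neighborhood_iff: "z \<in> neighborhood I M \<longleftrightarrow> (\<exists>x\<in>M. z \<in> neighborhood I {x})"
  using neighborhood_UN[of I M] by simp

section \<open>Subsets, unions and translates of 1-codes\<close>

lemma one_codeI:
  assumes "C \<subseteq> vecs I"
    and "\<And>x y z. x \<in> C \<Longrightarrow> y \<in> C \<Longrightarrow> z \<in> neighborhood I {x} \<Longrightarrow> z \<in> neighborhood I {y} \<Longrightarrow> x = y"
  shows "one_code I C"
  unfolding one_code_def
proof (intro conjI ballI impI equals0I)
  show "C \<subseteq> vecs I" by fact
  fix x y z assume "x \<in> C" "y \<in> C" "x \<noteq> y" "z \<in> neighborhood I {x} \<inter> neighborhood I {y}"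
  then show False using assms(2)[of x y z] by simp
qed

lemma one_codeD:
  assumes "one_code I C" "x \<in> C" "y \<in> C" "z \<in> neighborhood I {x}" "z \<in> neighborhood I {y}"
  shows "x = y"
proof (rule ccontr)
  assume "x \<noteq> y"
  then have "neighborhood I {x} \<inter> neighborhood I {y} = {}"
    using assms(1-3) by (simp add: one_code_def)
  then show False using assms(4,5) by (simp add: disjoint_iff)
qed

lemma one_code_subset_vecs: "one_code I C \<Longrightarrow> C \<subseteq> vecs I"
  by (simp add: one_code_def)

lemma one_code_subset: "one_code I C \<Longrightarrow> A \<subseteq> C \<Longrightarrow> one_code I A"
  by (rule one_codeI) (use one_code_subset_vecs in blast, rule one_codeD[of I C], auto)

lemma one_code_neighborhoods_disjoint:
  assumes "one_code I H" "A \<subseteq> H" "B \<subseteq> H" "A \<inter> B = {}"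
  shows "neighborhood I A \<inter> neighborhood I B = {}"
proof (rule equals0I)
  fix z assume "z \<in> neighborhood I A \<inter> neighborhood I B"
  then obtain x y where "x \<in> A" "y \<in> B" "z \<in> neighborhood I {x}" "z \<in> neighborhood I {y}"
    using mem_neighborhood_iff[of z I A] mem_neighborhood_iff[of z I B] by blast
  then show False using one_codeD[OF assms(1), of x y z] assms(2-4) by blast
qed

lemma one_code_UN:
  assumes code: "\<And>d. d \<in> D \<Longrightarrow> one_code I (A d)"
    and disj: "\<And>d d'. d \<in> D \<Longrightarrow> d' \<in> D \<Longrightarrow> d \<noteq> d' \<Longrightarrow>
      neighborhood I (A d) \<inter> neighborhood I (A d') = {}"
  shows "one_code I (\<Union>d\<in>D. A d)"
proof (rule one_codeI)
  show "(\<Union>d\<in>D. A d) \<subseteq> vecs I" using one_code_subset_vecs[OF code] by blast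
  fix x y z assume "x \<in> (\<Union>d\<in>D. A d)" "y \<in> (\<Union>d\<in>D. A d)"
    and z: "z \<in> neighborhood I {x}" "z \<in> neighborhood I {y}"
  then obtain d d' where d: "d \<in> D" "x \<in> A d" "d' \<in> D" "y \<in> A d'" by blast
  then have "z \<in> neighborhood I (A d)" "z \<in> neighborhood I (A d')"
    using z mem_neighborhood_iff by metis+
  then have "d = d'" using disj[OF d(1,3)] by blast
  then show "x = y" using one_codeD[OF code[OF d(1)] _ _ z] d by blast
qed

lemma one_code_Un:
  assumes "one_code I A" "one_code I B" "neighborhood I A \<inter> neighborhood I B = {}"
  shows "one_code I (A \<union> B)"
proof -
  have "one_code I (\<Union>b. if b then A else B)"
    using assms by (intro one_code_UN) (auto simp: Int_commute)
  moreover have "(\<Union>b. if b then A else B) = A \<union> B"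
    by (auto split: if_splits)
  ultimately show ?thesis by simp
qed

lemma one_code_translate:
  fixes t :: "'i \<Rightarrow> 'a::field"
  assumes "one_code I A" "t \<in> vecs I"
  shows "one_code I ((\<lambda>x. x + t) ` A)"
proof (rule one_codeI)
  show "(\<lambda>x. x + t) ` A \<subseteq> vecs I"
    using one_code_subset_vecs[OF assms(1)] assms(2) by (auto intro!: vecs_intros)
  fix x y z
  assume "x \<in> (\<lambda>x. x + t) ` A" "y \<in> (\<lambda>x. x + t) ` A"
    and z: "z \<in> neighborhood I {x}" "z \<in> neighborhood I {y}"
  then obtain x' y' where xy: "x' \<in> A" "y' \<in> A" "x = x' + t" "y = y' + t" by blast
  have "z - t \<in> neighborhood I {x'}" "z - t \<in> neighborhood I {y'}"
    using z unfolding xy neighborhood_translate[OF assms(2)] by auto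
  then have "x' = y'" by (rule one_codeD[OF assms(1) xy(1,2)])
  then show "x = y" using xy by simp
qed

text \<open>Each translated piece is again a 1-code, with the neighborhood of \<open>K d\<close>.
  Disjoint subsets of the 1-code \<open>H\<close> have disjoint neighborhoods, so the new pieces
  stay apart from each other and from the untouched rest of \<open>H\<close>, and the total
  neighborhood does not change.\<close>

lemma one_perfect_switching:
  fixes H :: "('i \<Rightarrow> 'a::field) set"
  assumes "one_perfect I H"
    and K: "\<And>d. d \<in> D \<Longrightarrow> K d \<subseteq> H"
    and disj: "\<And>d d'. d \<in> D \<Longrightarrow> d' \<in> D \<Longrightarrow> d \<noteq> d' \<Longrightarrow> K d \<inter> K d' = {}"
    and t: "\<And>d. d \<in> D \<Longrightarrow> t d \<in> vecs I"
    and nb: "\<And>d. d \<in> D \<Longrightarrow> neighborhood I ((\<lambda>x. x + t d) ` K d) = neighborhood I (K d)"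
  shows "one_perfect I ((H - (\<Union>d\<in>D. K d)) \<union> (\<Union>d\<in>D. (\<lambda>x. x + t d) ` K d))"
proof -
  let ?K = "\<Union>d\<in>D. K d" and ?K' = "\<Union>d\<in>D. (\<lambda>x. x + t d) ` K d"
  have H: "one_code I H" "neighborhood I H = vecs I"
    using assms(1) by (auto simp: one_perfect_def)
  note sub = one_code_subset[OF H(1)]
  have UN: "neighborhood I (\<Union>d\<in>D. A d) = (\<Union>d\<in>D. neighborhood I (A d))" for A :: "_ \<Rightarrow> ('i \<Rightarrow> 'a) set"
    by (auto simp: neighborhood_def)
  have Un: "neighborhood I (A \<union> B) = neighborhood I A \<union> neighborhood I B" for A B :: "('i \<Rightarrow> 'a) set"
    by (auto simp: neighborhood_def)
  have nb': "neighborhood I ?K' = neighborhood I ?K"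
    unfolding UN using nb by simp
  have "one_code I ?K'"
  proof (rule one_code_UN)
    show "one_code I ((\<lambda>x. x + t d) ` K d)" if "d \<in> D" for d
      using one_code_translate[OF sub[OF K] t] that by blast
    show "neighborhood I ((\<lambda>x. x + t d) ` K d) \<inter> neighborhood I ((\<lambda>x. x + t d') ` K d') = {}"
      if "d \<in> D" "d' \<in> D" "d \<noteq> d'" for d d'
      using one_code_neighborhoods_disjoint[OF H(1) K K disj] that nb by metis
  qed
  moreover have "neighborhood I (H - ?K) \<inter> neighborhood I ?K' = {}"
    unfolding nb' using K by (intro one_code_neighborhoods_disjoint[OF H(1)]) auto
  ultimately have "one_code I ((H - ?K) \<union> ?K')"
    using sub by (intro one_code_Un) auto
  moreover have "neighborhood I ((H - ?K) \<union> ?K') = neighborhood I ((H - ?K) \<union> ?K)"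
    unfolding Un nb' ..
  moreover have "(H - ?K) \<union> ?K = H" using K by blast
  ultimately show ?thesis using H(2) by (simp add: one_perfect_def)
qed

text \<open>Distinct codewords are at distance at least 3: if all differences were at
  \<open>i\<close> and \<open>j\<close>, copying coordinate \<open>i\<close> of \<open>y\<close>
  into \<open>x\<close> would give a vector within distance 1 of both.\<close>

lemma one_code_differ_outside_pair:
  fixes C :: "('i \<Rightarrow> 'a::zero) set"
  assumes "one_code I C" "x \<in> C" "y \<in> C" "x \<noteq> y"
  obtains k where "k \<noteq> i" "k \<noteq> j" "x k \<noteq> y k"
proof -
  have False if k: "\<And>k. k \<noteq> i \<Longrightarrow> k \<noteq> j \<Longrightarrow> x k = y k"
  proof -
    have C: "x \<in> vecs I" "y \<in> vecs I" using assms by (auto simp: one_code_def)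
    define z where "z = x(i := y i)"
    have "z \<in> vecs I" using C by (auto simp: z_def vecs_def)
    moreover have "{k \<in> I. x k \<noteq> z k} \<subseteq> {i}" "{k \<in> I. y k \<noteq> z k} \<subseteq> {j}"
      using k by (auto simp: z_def) metis
    then have "hamming_dist I x z \<le> 1" "hamming_dist I y z \<le> 1"
      using card_mono[of "{i}"] card_mono[of "{j}"] unfolding hamming_dist_def by fastforce+
    ultimately have "z \<in> neighborhood I {x} \<inter> neighborhood I {y}"
      by (auto simp: neighborhood_def)
    then show False using one_codeD[OF assms(1-3), of z] assms(4) by blast
  qed
  then show ?thesis using that by blast
qed

section \<open>Partial syndromes\<close>

text \<open>The coordinates of a word are themselves vectors, so a set \<open>S\<close> of vectors
  selects coordinates. \<open>S = UNIV\<close> gives the usual syndrome; a subspace \<open>S\<close>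
  gives the invariant that keeps the switched subsets apart.\<close>

definition partial_syndrome ::
  "nat \<Rightarrow> (nat \<Rightarrow> 'a::field) set \<Rightarrow> ((nat \<Rightarrow> 'a) \<Rightarrow> 'a) \<Rightarrow> (nat \<Rightarrow> 'a)" where
  "partial_syndrome m S c = (\<Sum>\<alpha>\<in>normalized m \<inter> S. scale (c \<alpha>) \<alpha>)"

lemma hamming_code_eq: "hamming_code m = {c \<in> vecs (normalized m). partial_syndrome m UNIV c = 0}"
  by (simp add: hamming_code_def partial_syndrome_def)

lemma partial_syndrome_add:
  "partial_syndrome m S (x + y) = partial_syndrome m S x + partial_syndrome m S y"
  by (simp add: partial_syndrome_def vs.scale_left_distrib sum.distrib)

lemma partial_syndrome_diff:
  "partial_syndrome m S (x - y) = partial_syndrome m S x - partial_syndrome m S y"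
  by (simp add: partial_syndrome_def vs.scale_left_diff_distrib sum_subtractf)

lemma partial_syndrome_0: "partial_syndrome m S 0 = 0"
  by (simp add: partial_syndrome_def)

lemma partial_syndrome_scale:
  "partial_syndrome m S (scale a x) = scale a (partial_syndrome m S x)"
proof -
  have "scale (scale a x \<alpha>) \<alpha> = scale a (scale (x \<alpha>) \<alpha>)" for \<alpha>
    by (simp add: scale_def mult.assoc)
  then show ?thesis unfolding partial_syndrome_def vs.scale_sum_right by (intro sum.cong refl)
qed

lemma partial_syndrome_sum:
  "partial_syndrome m S (\<Sum>i\<in>J. f i) = (\<Sum>i\<in>J. partial_syndrome m S (f i))"
  by (induction J rule: infinite_finite_induct)
    (simp_all only: not_False_eq_True sum.infinite sum.empty sum.insert partial_syndrome_add partial_syndrome_0)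

lemma partial_syndrome_unit_vec:
  fixes \<beta> :: "nat \<Rightarrow> 'a::{field,finite}"
  assumes "\<beta> \<in> normalized m"
  shows "partial_syndrome m S (unit_vec \<beta>) = (if \<beta> \<in> S then \<beta> else 0)"
proof -
  have "partial_syndrome m S (unit_vec \<beta>) = (\<Sum>\<alpha>\<in>normalized m \<inter> S. if \<alpha> = \<beta> then \<beta> else 0)"
    unfolding partial_syndrome_def by (intro sum.cong) (auto simp: unit_vec_def)
  then show ?thesis using assms finite_normalized[of m, where 'a = 'a] by (simp add: sum.delta)
qed

lemma partial_syndrome_pad:
  fixes \<alpha> :: "nat \<Rightarrow> 'a::{field,finite}"
  shows "partial_syndrome m S (pad m \<alpha>) =
    (\<Sum>i<m. scale (\<alpha> i) (if unit_vec i \<in> S then unit_vec i else 0))"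
  unfolding pad_def partial_syndrome_sum partial_syndrome_scale
  by (intro sum.cong) (simp_all add: partial_syndrome_unit_vec unit_vec_in_normalized)

lemma sum_scale_unit_vec:
  assumes "\<alpha> \<in> vecs {..<m}"
  shows "(\<Sum>i<m. scale (\<alpha> i) (unit_vec i)) = (\<alpha> :: nat \<Rightarrow> 'a::field)"
proof
  fix k
  have "(\<Sum>i<m. scale (\<alpha> i) (unit_vec i)) k = (\<Sum>i<m. scale (\<alpha> i) (unit_vec i) k)"
    by (induction m) auto
  also have "\<dots> = (\<Sum>i<m. if k = i then \<alpha> i else 0)"
    by (intro sum.cong) (auto simp: scale_def unit_vec_def)
  also have "\<dots> = \<alpha> k" using assms by (auto simp: vecs_def)
  finally show "(\<Sum>i<m. scale (\<alpha> i) (unit_vec i)) k = \<alpha> k" .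
qed

text \<open>Padding is a right inverse of the syndrome map, because the unit vectors are among the
  coordinates.\<close>

lemma syndrome_pad:
  fixes \<alpha> :: "nat \<Rightarrow> 'a::{field,finite}"
  assumes "\<alpha> \<in> vecs {..<m}"
  shows "partial_syndrome m UNIV (pad m \<alpha>) = \<alpha>"
  by (simp add: partial_syndrome_pad sum_scale_unit_vec[OF assms])

lemma pad_in_vecs: "pad m \<alpha> \<in> vecs (normalized m)"
  unfolding pad_def
  by (intro vs.subspace_sum vecs_subspace vecs_intros unit_vec_in_normalized) auto

lemma syndrome_in_vecs: "partial_syndrome m S c \<in> vecs {..<m}"
  unfolding partial_syndrome_def
  by (intro vs.subspace_sum vecs_subspace vecs_intros) (auto simp: normalized_def)

section \<open>Normalized vectors as representatives of the points of projective space\<close>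

lemma scale_normalized_inj:
  assumes "\<alpha> \<in> normalized m" "\<beta> \<in> normalized m" "scale a \<alpha> = scale b \<beta>" "a \<noteq> 0"
  shows "a = b" "\<alpha> = (\<beta> :: nat \<Rightarrow> 'a::field)"
proof -
  have "b \<noteq> 0"
    using assms by (auto simp: normalized_def)
  then have "(a, \<alpha>) = (b, \<beta>)"
    using bij_betw_normalized[of m, where 'a = 'a] assms
    unfolding bij_betw_def by (auto dest!: inj_onD[where x = "(a, \<alpha>)" and y = "(b, \<beta>)"])
  then show "a = b" "\<alpha> = \<beta>" by auto
qed

text \<open>Surjectivity in \<open>bij_betw_normalized\<close>. A nonzero syndrome thus reveals the
  position \<open>\<alpha>\<close> and the value \<open>a\<close> of a single error.\<close>

lemma normalized_multiple:
  assumes "x \<in> vecs {..<m}" "x \<noteq> (0 :: nat \<Rightarrow> 'a::field)"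
  obtains a \<alpha> where "a \<noteq> 0" "\<alpha> \<in> normalized m" "x = scale a \<alpha>"
proof -
  have "x \<in> (\<lambda>(a, \<alpha>). scale a \<alpha>) ` ((UNIV - {0}) \<times> normalized m)"
    using bij_betw_normalized[of m, where 'a = 'a] assms unfolding bij_betw_def by blast
  then show ?thesis using that by auto
qed

section \<open>The Hamming code and its components\<close>

lemma hamming_code_subspace: "vs.subspace (hamming_code m)"
  unfolding vs.subspace_def hamming_code_eq
  by (auto simp: partial_syndrome_add partial_syndrome_scale partial_syndrome_0 intro!: vecs_intros)

lemma normalized_nonempty: "m \<ge> 1 \<Longrightarrow> normalized m \<noteq> ({} :: (nat \<Rightarrow> 'a::field) set)"
  using unit_vec_in_normalized[of 0 m] by auto

lemma neighborhood_normalized_eq: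
  fixes M :: "((nat \<Rightarrow> 'a::{field,finite}) \<Rightarrow> 'a) set"
  assumes "m \<ge> 1" "M \<subseteq> vecs (normalized m)"
  shows "neighborhood (normalized m) M =
    {x + scale b (unit_vec j) | x b j. x \<in> M \<and> j \<in> normalized m}"
  by (rule neighborhood_eq[OF finite_normalized normalized_nonempty[OF assms(1)] assms(2)])

text \<open>Syndrome decoding: adding \<open>b\<close> at coordinate \<open>\<beta>\<close> to a
  codeword produces the syndrome \<open>scale b \<beta>\<close>. This determines the error vector,
  and every nonzero vector of \<open>vecs {..<m}\<close> arises in this way.\<close>

lemma one_perfect_hamming_code:
  assumes "m \<ge> 1"
  shows "one_perfect (normalized m) (hamming_code m :: ((nat \<Rightarrow> 'a::{field,finite}) \<Rightarrow> 'a) set)"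
proof -
  let ?I = "normalized m :: (nat \<Rightarrow> 'a) set" and ?H = "hamming_code m :: ((nat \<Rightarrow> 'a) \<Rightarrow> 'a) set"
  note nb = neighborhood_normalized_eq[OF assms]
  have sub: "?H \<subseteq> vecs ?I" by (auto simp: hamming_code_def)
  have "x = y" if xy: "x \<in> ?H" "y \<in> ?H" and z: "z \<in> neighborhood ?I {x}" "z \<in> neighborhood ?I {y}"
    for x y z
  proof -
    have "{x} \<subseteq> vecs ?I" "{y} \<subseteq> vecs ?I" using xy sub by auto
    then obtain a \<alpha> b \<beta> where ab: "\<alpha> \<in> ?I" "\<beta> \<in> ?I"
        "x + scale a (unit_vec \<alpha>) = y + scale b (unit_vec \<beta>)"
      using z nb[of "{x}"] nb[of "{y}"] by auto
    have "partial_syndrome m UNIV (x + scale a (unit_vec \<alpha>)) =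
        partial_syndrome m UNIV (y + scale b (unit_vec \<beta>))"
      using ab(3) by simp
    then have eq: "scale a \<alpha> = scale b \<beta>"
      using xy(1,2) ab(1,2)
      by (simp add: hamming_code_eq partial_syndrome_add partial_syndrome_scale
          partial_syndrome_unit_vec)
    \<comment> \<open>Only the error vectors are compared: when both values are 0, the positions
      \<open>\<alpha>\<close> and \<open>\<beta>\<close> may differ.\<close>
    have "scale a (unit_vec \<alpha>) = scale b (unit_vec \<beta>)"
    proof (cases "a = 0")
      case True
      then show ?thesis
        using scale_normalized_inj(1)[OF ab(2,1) eq[symmetric]] by auto
    next
      case False
      then show ?thesis using scale_normalized_inj[OF ab(1,2) eq] by auto
    qed
    then show ?thesis using ab(3) by simp
  qed
  then have "one_code ?I ?H" using sub by (intro one_codeI)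
  moreover have "y \<in> neighborhood ?I ?H" if y: "y \<in> vecs ?I" for y
  proof (cases "partial_syndrome m UNIV y = 0")
    case True
    then have "y \<in> ?H" using y by (simp add: hamming_code_eq)
    then show ?thesis using y by (force simp: neighborhood_def hamming_dist_def)
  next
    case False
    then obtain a \<alpha> where a: "a \<noteq> 0" "\<alpha> \<in> ?I" "partial_syndrome m UNIV y = scale a \<alpha>"
      using normalized_multiple syndrome_in_vecs by metis
    then have "y - scale a (unit_vec \<alpha>) \<in> ?H"
      using y by (auto simp: hamming_code_eq partial_syndrome_diff partial_syndrome_scale
          partial_syndrome_unit_vec intro!: vecs_intros)
    moreover have "y = (y - scale a (unit_vec \<alpha>)) + scale a (unit_vec \<alpha>)" by simp
    ultimately show ?thesis unfolding nb[OF sub] using a(2) by blast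
  qed
  moreover have "neighborhood ?I ?H \<subseteq> vecs ?I" by (auto simp: neighborhood_def)
  ultimately show ?thesis unfolding one_perfect_def by blast
qed

section \<open>Linear components and their triples\<close>

lemma linear_component_subspace: "vs.subspace (linear_component m \<delta>)"
  by (simp add: linear_component_def)

lemma linear_component_subset_hamming_code: "linear_component m \<delta> \<subseteq> hamming_code m"
  unfolding linear_component_def
  by (rule vs.span_minimal[OF _ hamming_code_subspace]) (auto simp: triples_def)

text \<open>The support \<open>\<delta>\<close>, \<open>\<beta>\<close>, \<open>\<gamma>\<close> of
  a triple is collinear, so a subspace through \<open>\<delta>\<close> contains both other points or
  neither. In the first case the full syndrome 0 results; in the second only \<open>\<delta>\<close>
  contributes, with coefficient 1.\<close>

lemma partial_syndrome_triples:
  fixes \<delta> :: "nat \<Rightarrow> 'a::{field,finite}"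
  assumes c: "c \<in> triples m \<delta>" and "\<delta> \<in> normalized m" and S: "vs.subspace S" "\<delta> \<in> S"
  shows "partial_syndrome m S c \<in> {0, \<delta>}"
proof -
  let ?supp = "{\<alpha> \<in> normalized m. c \<alpha> \<noteq> 0}"
  have card: "card ?supp = 3" and "c \<delta> = 1" and syn: "partial_syndrome m UNIV c = 0"
    using c by (auto simp: triples_def hamming_code_eq)
  have fin: "finite ?supp" using card by (simp add: card_ge_0_finite)
  have "\<delta> \<in> ?supp" using assms(2) \<open>c \<delta> = 1\<close> by simp
  then have "card (?supp - {\<delta>}) = 2" using card fin by simp
  then obtain \<beta> \<gamma> where bg: "?supp - {\<delta>} = {\<beta>, \<gamma>}" "\<beta> \<noteq> \<gamma>"
    by (meson card_2_iff)
  then have supp: "?supp = {\<delta>, \<beta>, \<gamma>}" and ne: "\<beta> \<noteq> \<delta>" "\<gamma> \<noteq> \<delta>" "c \<beta> \<noteq> 0" "c \<gamma> \<noteq> 0"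
    using \<open>\<delta> \<in> ?supp\<close> by blast+
  have *: "partial_syndrome m U c = (\<Sum>\<alpha>\<in>{\<delta>, \<beta>, \<gamma>} \<inter> U. scale (c \<alpha>) \<alpha>)" for U
    unfolding partial_syndrome_def supp[symmetric] using finite_normalized[of m]
    by (intro sum.mono_neutral_right) auto
  have rel: "\<delta> + (scale (c \<beta>) \<beta> + scale (c \<gamma>) \<gamma>) = 0"
    using syn ne bg(2) \<open>c \<delta> = 1\<close> by (simp add: *)
  \<comment> \<open>Solves the linear relation for one of the two other points; stated for a generic
    pair so that it serves both directions.\<close>
  have mem: "\<eta> \<in> S" if "\<epsilon> \<in> S" "c \<eta> \<noteq> 0" "\<delta> + (scale (c \<epsilon>) \<epsilon> + scale (c \<eta>) \<eta>) = 0" for \<epsilon> \<eta>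
  proof -
    have "scale (c \<eta>) \<eta> = - (\<delta> + scale (c \<epsilon>) \<epsilon>)"
      using that(3) by (metis add.assoc minus_unique)
    moreover have "\<delta> + scale (c \<epsilon>) \<epsilon> \<in> S"
      using that(1) S by (intro vs.subspace_add vs.subspace_scale)
    ultimately have "scale (c \<eta>) \<eta> \<in> S"
      using vs.subspace_neg[OF S(1)] by metis
    then have "scale (inverse (c \<eta>)) (scale (c \<eta>) \<eta>) \<in> S"
      by (rule vs.subspace_scale[OF S(1)])
    then show ?thesis using that(2) by simp
  qed
  have "\<beta> \<in> S \<longleftrightarrow> \<gamma> \<in> S"
    using mem[of \<beta> \<gamma>] mem[of \<gamma> \<beta>] rel ne by (auto simp: add.commute)
  then consider "{\<delta>, \<beta>, \<gamma>} \<inter> S = {\<delta>, \<beta>, \<gamma>} \<inter> UNIV" | "{\<delta>, \<beta>, \<gamma>} \<inter> S = {\<delta>}"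
    using S(2) by auto
  then show ?thesis
  proof cases
    case 1
    have "partial_syndrome m S c = partial_syndrome m UNIV c" unfolding * 1 ..
    then show ?thesis using syn by simp
  next
    case 2
    have "partial_syndrome m S c = \<delta>" unfolding * 2 using \<open>c \<delta> = 1\<close> by simp
    then show ?thesis by simp
  qed
qed

text \<open>The preimage of \<open>L\<close> under the linear map
  \<open>partial_syndrome m S\<close> is a subspace containing the triples, hence their span.
  Leaving \<open>L\<close> free lets two components share one \<open>L\<close>.\<close>

lemma partial_syndrome_linear_component:
  fixes \<delta> :: "nat \<Rightarrow> 'a::{field,finite}"
  assumes "r \<in> linear_component m \<delta>" "\<delta> \<in> normalized m"
    and "vs.subspace S" "\<delta> \<in> S" "vs.subspace L" "\<delta> \<in> L"
  shows "partial_syndrome m S r \<in> L"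
proof -
  have "vs.subspace {r. partial_syndrome m S r \<in> L}"
    using assms(5) by (auto simp: vs.subspace_def partial_syndrome_0 partial_syndrome_add
        partial_syndrome_scale)
  moreover have "triples m \<delta> \<subseteq> {r. partial_syndrome m S r \<in> L}"
    using partial_syndrome_triples[OF _ assms(2-4)] assms(5,6) vs.subspace_0 by fastforce
  ultimately show ?thesis
    using vs.span_minimal assms(1) unfolding linear_component_def by blast
qed

text \<open>The point \<open>\<gamma>\<close> represents
  \<open>scale b \<beta> - scale a \<delta>\<close>, a third point of the line through
  \<open>\<beta>\<close> and \<open>\<delta>\<close>. The displayed word then has syndrome 0 and
  weight 3, so it is a multiple of a triple.\<close>

lemma triple_through:
  fixes \<delta> :: "nat \<Rightarrow> 'a::{field,finite}"
  assumes d: "\<delta> \<in> normalized m" "\<beta> \<in> normalized m" "\<beta> \<noteq> \<delta>" "a \<noteq> 0" "b \<noteq> 0"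
  obtains c \<gamma> where "\<gamma> \<in> normalized m"
    "scale b (unit_vec \<beta>) - scale a (unit_vec \<delta>) - scale c (unit_vec \<gamma>) \<in> linear_component m \<delta>"
proof -
  have "scale b \<beta> - scale a \<delta> \<noteq> 0"
    using scale_normalized_inj(2)[OF d(2,1) _ d(5)] d(3) by auto
  moreover have "scale b \<beta> - scale a \<delta> \<in> vecs {..<m}"
    using d by (auto simp: normalized_def intro!: vecs_intros)
  ultimately obtain c \<gamma> where c: "c \<noteq> 0" "\<gamma> \<in> normalized m" "scale b \<beta> - scale a \<delta> = scale c \<gamma>"
    using normalized_multiple by metis
  have "\<gamma> \<noteq> \<delta>"
  proof
    assume "\<gamma> = \<delta>"
    then have "scale b \<beta> = scale (c + a) \<delta>"
      using c(3) by (simp add: vs.scale_left_distrib diff_eq_eq)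
    then show False using scale_normalized_inj(2)[OF d(2,1) _ d(5)] d(3) by blast
  qed
  have "\<gamma> \<noteq> \<beta>"
  proof
    assume "\<gamma> = \<beta>"
    then have "scale a \<delta> = scale (b - c) \<beta>"
      using c(3) by (simp add: vs.scale_left_diff_distrib diff_eq_eq eq_diff_eq add.commute)
    then show False using scale_normalized_inj(2)[OF d(1,2) _ d(4)] d(3) by blast
  qed
  define s where "s = scale b (unit_vec \<beta>) - scale a (unit_vec \<delta>) - scale c (unit_vec \<gamma>)"
  \<comment> \<open>The coefficient of \<open>s\<close> at \<open>\<delta>\<close> is
    \<open>- a\<close>; this factor turns it into the 1 that \<open>triples\<close> demands.\<close>
  define t where "t = scale (- inverse a) s"
  have "s \<in> hamming_code m"
    using d c unfolding s_def
    by (auto simp: hamming_code_eq partial_syndrome_diff partial_syndrome_scale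
          partial_syndrome_unit_vec intro!: vecs_intros)
  then have "t \<in> hamming_code m"
    unfolding t_def by (rule vs.subspace_scale[OF hamming_code_subspace])
  moreover have "t \<delta> = 1"
    using d \<open>\<gamma> \<noteq> \<delta>\<close> by (simp add: t_def s_def scale_def unit_vec_def)
  moreover have "{\<alpha> \<in> normalized m. t \<alpha> \<noteq> 0} = {\<beta>, \<delta>, \<gamma>}"
    using d c \<open>\<gamma> \<noteq> \<delta>\<close> \<open>\<gamma> \<noteq> \<beta>\<close> by (auto simp: t_def s_def scale_def unit_vec_def split: if_splits)
  ultimately have "t \<in> triples m \<delta>"
    using d(3) \<open>\<gamma> \<noteq> \<delta>\<close> \<open>\<gamma> \<noteq> \<beta>\<close> by (simp add: triples_def)
  then have "scale (- a) t \<in> linear_component m \<delta>"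
    unfolding linear_component_def by (intro vs.span_scale vs.span_base)
  moreover have "scale (- a) t = s" using d(4) by (simp add: t_def)
  ultimately show ?thesis using that c(2) s_def by metis
qed

text \<open>Modulo the component, an error at \<open>\<beta>\<close> is the shift at
  \<open>\<delta>\<close> plus an error at the third point \<open>\<gamma>\<close>. The shift by a
  general \<open>a\<close> is allowed so that the shift can also be undone.\<close>

lemma neighborhood_subset_component_shift:
  fixes K :: "((nat \<Rightarrow> 'a::{field,finite}) \<Rightarrow> 'a) set"
  assumes "m \<ge> 1" and \<delta>: "\<delta> \<in> normalized m" and K: "K \<subseteq> vecs (normalized m)"
    and closed: "\<And>k r. k \<in> K \<Longrightarrow> r \<in> linear_component m \<delta> \<Longrightarrow> k + r \<in> K"
  shows "neighborhood (normalized m) K \<subseteq>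
    neighborhood (normalized m) ((\<lambda>k. k + scale a (unit_vec \<delta>)) ` K)"
proof
  note nb = neighborhood_normalized_eq[OF assms(1)]
  have K': "(\<lambda>k. k + scale a (unit_vec \<delta>)) ` K \<subseteq> vecs (normalized m)"
    using K \<delta> by (auto intro!: vecs_intros)
  fix y assume "y \<in> neighborhood (normalized m) K"
  then obtain k b \<beta> where y: "k \<in> K" "\<beta> \<in> normalized m" "y = k + scale b (unit_vec \<beta>)"
    using nb[OF K] by auto
  \<comment> \<open>Without a genuine triple (\<open>a = 0\<close>, \<open>b = 0\<close> or
    \<open>\<beta> = \<delta>\<close>), \<open>k\<close> itself serves as \<open>k'\<close>, with
    the error left at \<open>\<beta>\<close> or corrected at \<open>\<delta>\<close>.\<close>
  have "\<exists>k'\<in>K. \<exists>\<gamma>\<in>normalized m. \<exists>c. y = k' + scale a (unit_vec \<delta>) + scale c (unit_vec \<gamma>)"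
  proof (cases "a = 0 \<or> b = 0 \<or> \<beta> = \<delta>")
    case True
    then consider "a = 0" | "b = 0" | "\<beta> = \<delta>" by blast
    then show ?thesis
    proof cases
      case 1
      then show ?thesis using y by auto
    next
      case 2
      have "y = k + scale a (unit_vec \<delta>) + scale (- a) (unit_vec \<delta>)"
        using y 2 by simp
      then show ?thesis using y(1) \<delta> by blast
    next
      case 3
      have "y = k + scale a (unit_vec \<delta>) + scale (b - a) (unit_vec \<delta>)"
        using y 3 by (simp add: vs.scale_left_diff_distrib)
      then show ?thesis using y(1) \<delta> by blast
    qed
  next
    case False
    then obtain c \<gamma> where c: "\<gamma> \<in> normalized m" and s:
        "scale b (unit_vec \<beta>) - scale a (unit_vec \<delta>) - scale c (unit_vec \<gamma>) \<in> linear_component m \<delta>"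
      using triple_through[OF \<delta> y(2)] by metis
    have "y = k + (scale b (unit_vec \<beta>) - scale a (unit_vec \<delta>) - scale c (unit_vec \<gamma>))
        + scale a (unit_vec \<delta>) + scale c (unit_vec \<gamma>)"
      using y(3) by simp
    then show ?thesis using closed[OF y(1) s] c by blast
  qed
  then show "y \<in> neighborhood (normalized m) ((\<lambda>k. k + scale a (unit_vec \<delta>)) ` K)"
    unfolding nb[OF K'] by blast
qed

text \<open>The shifted set is closed under the component too, so the reverse inclusion is the
  forward one applied to it with \<open>a = - 1\<close>.\<close>

lemma neighborhood_component_shift:
  fixes K :: "((nat \<Rightarrow> 'a::{field,finite}) \<Rightarrow> 'a) set"
  assumes "m \<ge> 1" and \<delta>: "\<delta> \<in> normalized m" and K: "K \<subseteq> vecs (normalized m)"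
    and closed: "\<And>k r. k \<in> K \<Longrightarrow> r \<in> linear_component m \<delta> \<Longrightarrow> k + r \<in> K"
  shows "neighborhood (normalized m) ((\<lambda>k. k + unit_vec \<delta>) ` K) = neighborhood (normalized m) K"
proof
  let ?K' = "(\<lambda>k. k + unit_vec \<delta>) ` K"
  show "neighborhood (normalized m) K \<subseteq> neighborhood (normalized m) ?K'"
    using neighborhood_subset_component_shift[OF assms, of 1] by simp
  have "?K' \<subseteq> vecs (normalized m)"
    using K \<delta> by (auto intro!: vecs_intros)
  moreover have "k + r \<in> ?K'" if "k \<in> ?K'" "r \<in> linear_component m \<delta>" for k r
    using that closed by (auto simp: image_iff algebra_simps)
  moreover have "(\<lambda>k. k + scale (- 1) (unit_vec \<delta>)) ` ?K' = K"
    by (simp add: image_comp comp_def)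
  ultimately show "neighborhood (normalized m) ?K' \<subseteq> neighborhood (normalized m) K"
    using neighborhood_subset_component_shift[OF assms(1) \<delta>, of ?K' "- 1"] by simp
qed

section \<open>Disjointness of the switched subsets\<close>

lemma components_disjoint:
  fixes \<delta> \<epsilon> :: "nat \<Rightarrow> 'a::{field,finite}"
  assumes \<delta>: "\<delta> \<in> normalized m" and \<epsilon>: "\<epsilon> \<in> normalized m" and "\<delta> 0 = \<epsilon> 0" "\<delta> 0 \<noteq> 0" "\<delta> \<noteq> \<epsilon>"
    and far: "\<And>i j. \<exists>k. k \<noteq> i \<and> k \<noteq> j \<and> \<delta> k \<noteq> \<epsilon> k"
    and r: "r \<in> linear_component m \<delta>" and s: "s \<in> linear_component m \<epsilon>"
  shows "r + pad m \<delta> - unit_vec \<delta> \<noteq> s + pad m \<epsilon> - unit_vec \<epsilon>"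
proof
  assume eq: "r + pad m \<delta> - unit_vec \<delta> = s + pad m \<epsilon> - unit_vec \<epsilon>"
  obtain i where i: "\<delta> i \<noteq> \<epsilon> i" using \<open>\<delta> \<noteq> \<epsilon>\<close> by blast
  have "i < m" using i \<delta> \<epsilon> by (auto simp: normalized_def vecs_def not_less)
  define L where "L = vs.span {\<delta>, \<epsilon>}"
  define S where "S = vs.span {unit_vec i, \<delta>, \<epsilon>}"
  have L: "vs.subspace L" "\<delta> \<in> L" "\<epsilon> \<in> L" by (auto simp: L_def intro: vs.span_base)
  have S: "vs.subspace S" "\<delta> \<in> S" "\<epsilon> \<in> S" by (auto simp: S_def intro: vs.span_base)
  \<comment> \<open>Unit vectors at coordinates where \<open>\<delta>\<close> and
    \<open>\<epsilon>\<close> differ therefore vanish at 0, as \<open>L_elim\<close>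
    requires.\<close>
  have unit0: "j \<noteq> 0" if "\<delta> j \<noteq> \<epsilon> j" for j
    using that assms(3) by metis
  \<comment> \<open>Coordinate 0 of \<open>scale a \<delta> + scale b \<epsilon>\<close> is
    \<open>(a + b) * \<delta> 0\<close>, so its vanishing forces \<open>b = - a\<close>.\<close>
  have L_elim: "\<exists>a. x = scale a (\<delta> - \<epsilon>)" if x: "x \<in> L" "x 0 = 0" for x
  proof -
    obtain a b where x_eq: "x = scale a \<delta> + scale b \<epsilon>"
      using x(1) unfolding L_def vs.span_breakdown_eq[of _ \<delta>] vs.span_breakdown_eq[of _ \<epsilon>]
      by (auto simp: diff_eq_eq add.commute)
    then have "(a + b) * \<delta> 0 = 0" using x(2) assms(3) by (simp add: scale_def algebra_simps)
    then have "b = - a" using assms(4) by (simp add: eq_neg_iff_add_eq_0 add.commute)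
    then show ?thesis unfolding x_eq by (auto simp: vs.scale_right_diff_distrib)
  qed
  \<comment> \<open>Otherwise a combination of the unit vectors at \<open>i\<close> and
    \<open>j\<close> would be a multiple of \<open>\<delta> - \<epsilon>\<close>. A third differing
    coordinate makes the factor 0, contradicting the entry 1 at \<open>j\<close>.\<close>
  have unit_S: "j = i" if j: "unit_vec j \<in> S" "\<delta> j \<noteq> \<epsilon> j" for j
  proof (rule ccontr)
    assume "j \<noteq> i"
    obtain c where c: "unit_vec j - scale c (unit_vec i) \<in> L"
      using j(1) unfolding S_def L_def vs.span_breakdown_eq[of _ "unit_vec i"] by blast
    moreover have "(unit_vec j - scale c (unit_vec i)) 0 = 0"
      using unit0[OF j(2)] unit0[OF i] by (simp add: unit_vec_def scale_def)
    ultimately obtain a where a: "unit_vec j - scale c (unit_vec i) = scale a (\<delta> - \<epsilon>)"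
      using L_elim by blast
    obtain k where k: "k \<noteq> i" "k \<noteq> j" "\<delta> k \<noteq> \<epsilon> k" using far by blast
    have "a = 0" using fun_cong[OF a, of k] k by (simp add: unit_vec_def scale_def)
    then show False using fun_cong[OF a, of j] \<open>j \<noteq> i\<close> by (simp add: unit_vec_def scale_def)
  qed
  have unit_L: "unit_vec i \<notin> L"
  proof
    assume "unit_vec i \<in> L"
    moreover have "(unit_vec i :: nat \<Rightarrow> 'a) 0 = 0"
      using unit0[OF i] by (simp add: unit_vec_def)
    ultimately obtain a where a: "unit_vec i = scale a (\<delta> - \<epsilon>)"
      using L_elim by blast
    obtain k where k: "k \<noteq> i" "\<delta> k \<noteq> \<epsilon> k" using far by blast
    have "a = 0" using fun_cong[OF a, of k] k by (simp add: unit_vec_def scale_def)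
    then show False using fun_cong[OF a, of i] by (simp add: unit_vec_def scale_def)
  qed
  let ?p = "partial_syndrome m S"
  have "?p (pad m \<delta>) - ?p (pad m \<epsilon>) =
      (\<Sum>j<m. scale (\<delta> j - \<epsilon> j) (if unit_vec j \<in> S then unit_vec j else 0))"
    by (simp add: partial_syndrome_pad vs.scale_left_diff_distrib sum_subtractf)
  also have "\<dots> = (\<Sum>j<m. if j = i then scale (\<delta> i - \<epsilon> i) (unit_vec i) else 0)"
  proof (intro sum.cong refl)
    \<comment> \<open>Terms with \<open>j \<noteq> i\<close> vanish, either because the coefficient
      is 0 or because coordinate \<open>unit_vec j\<close> lies outside \<open>S\<close>.\<close>
    fix j
    have unit_i: "unit_vec i \<in> S" unfolding S_def by (rule vs.span_base) simp
    consider "j = i" | "j \<noteq> i" "\<delta> j = \<epsilon> j" | "j \<noteq> i" "unit_vec j \<notin> S"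
      using unit_S[of j] by blast
    then show "scale (\<delta> j - \<epsilon> j) (if unit_vec j \<in> S then unit_vec j else 0) =
        (if j = i then scale (\<delta> i - \<epsilon> i) (unit_vec i) else 0)"
    proof cases
      case 1
      then show ?thesis using unit_i by (simp only: if_True simp_thms)
    next
      case 2
      then show ?thesis by (simp only: diff_self vs.scale_zero_left if_False)
    next
      case 3
      then show ?thesis by (simp only: if_False vs.scale_zero_right simp_thms)
    qed
  qed
  also have "\<dots> = scale (\<delta> i - \<epsilon> i) (unit_vec i)" using \<open>i < m\<close> by simp
  finally have pads: "?p (pad m \<delta>) - ?p (pad m \<epsilon>) = scale (\<delta> i - \<epsilon> i) (unit_vec i)" .
  have "pad m \<delta> - pad m \<epsilon> = (s - r) + (unit_vec \<delta> - unit_vec \<epsilon>)"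
    using eq by (simp add: algebra_simps)
  then have "?p (pad m \<delta> - pad m \<epsilon>) = ?p ((s - r) + (unit_vec \<delta> - unit_vec \<epsilon>))"
    by (rule arg_cong)
  then have "?p (pad m \<delta>) - ?p (pad m \<epsilon>) = (?p s - ?p r) + (\<delta> - \<epsilon>)"
    unfolding partial_syndrome_diff partial_syndrome_add partial_syndrome_unit_vec[OF \<delta>]
      partial_syndrome_unit_vec[OF \<epsilon>] if_P[OF S(2)] if_P[OF S(3)] .
  moreover have "?p r \<in> L" "?p s \<in> L"
    using partial_syndrome_linear_component[OF r \<delta> S(1,2) L(1,2)]
      partial_syndrome_linear_component[OF s \<epsilon> S(1,3) L(1,3)] by auto
  \<comment> \<open>In the preceding equation every term on the right lies in \<open>L\<close>, so
    the left side, a nonzero multiple of \<open>unit_vec i\<close>, does as well.\<close>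
  ultimately have "scale (\<delta> i - \<epsilon> i) (unit_vec i) \<in> L"
    using L pads by (simp add: vs.subspace_add vs.subspace_diff)
  then have "scale (inverse (\<delta> i - \<epsilon> i)) (scale (\<delta> i - \<epsilon> i) (unit_vec i)) \<in> L"
    by (rule vs.subspace_scale[OF L(1)])
  then show False using i unit_L by simp
qed

section \<open>Simultaneous switching of the Hamming code\<close>

lemma pad_diff_unit_vec_in_hamming_code:
  fixes \<delta> :: "nat \<Rightarrow> 'a::{field,finite}"
  assumes "\<delta> \<in> normalized m"
  shows "pad m \<delta> - unit_vec \<delta> \<in> hamming_code m"
proof -
  have "\<delta> \<in> vecs {..<m}" using assms by (simp add: normalized_def)
  then show ?thesis
    using assms by (auto simp: hamming_code_eq partial_syndrome_diff syndrome_pad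
        partial_syndrome_unit_vec intro!: vecs_intros pad_in_vecs)
qed

lemma one_perfect_switched_code:
  fixes C :: "(nat \<Rightarrow> 'a::{field,finite}) set"
  assumes "m \<ge> 1" and C: "one_code {..<m - 1} C"
  shows "one_perfect (normalized m) (switched_code m C)"
proof -
  define K where "K \<delta> = (\<lambda>r. r + pad m \<delta> - unit_vec \<delta>) ` linear_component m \<delta>"
    for \<delta> :: "nat \<Rightarrow> 'a"
  let ?D = "prepend_one ` C"
  have D: "\<delta> \<in> normalized m" if "\<delta> \<in> ?D" for \<delta>
    using that prepend_one_in_normalized[OF assms(1)] one_code_subset_vecs[OF C] by blast
  have KH: "K \<delta> \<subseteq> hamming_code m" if "\<delta> \<in> ?D" for \<delta>
    using vs.subspace_add[OF hamming_code_subspace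
        subsetD[OF linear_component_subset_hamming_code[of m \<delta>]]
        pad_diff_unit_vec_in_hamming_code[OF D[OF that]]]
    by (auto simp: K_def add_diff_eq)
  have "one_perfect (normalized m) ((hamming_code m - (\<Union>\<delta>\<in>?D. K \<delta>)) \<union>
      (\<Union>\<delta>\<in>?D. (\<lambda>x. x + unit_vec \<delta>) ` K \<delta>))"
  proof (rule one_perfect_switching)
    show "one_perfect (normalized m) (hamming_code m :: ((nat \<Rightarrow> 'a) \<Rightarrow> 'a) set)"
      using assms(1) by (rule one_perfect_hamming_code)
    show "K \<delta> \<subseteq> hamming_code m" if "\<delta> \<in> ?D" for \<delta> using KH[OF that] .
    show "unit_vec \<delta> \<in> vecs (normalized m)" if "\<delta> \<in> ?D" for \<delta>
      using D[OF that] by (rule unit_vec_in_vecs)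
    show "neighborhood (normalized m) ((\<lambda>x. x + unit_vec \<delta>) ` K \<delta>) =
        neighborhood (normalized m) (K \<delta>)" if "\<delta> \<in> ?D" for \<delta>
    proof (rule neighborhood_component_shift[OF assms(1) D[OF that]])
      show "K \<delta> \<subseteq> vecs (normalized m)"
        using KH[OF that] by (auto simp: hamming_code_def)
      show "k + r \<in> K \<delta>" if k: "k \<in> K \<delta>" and r: "r \<in> linear_component m \<delta>" for k r
      proof -
        obtain r' where r': "r' \<in> linear_component m \<delta>" "k = r' + pad m \<delta> - unit_vec \<delta>"
          using k by (auto simp: K_def)
        then have "k + r = (r' + r) + pad m \<delta> - unit_vec \<delta>" by simp
        then show ?thesis
          unfolding K_def using vs.subspace_add[OF linear_component_subspace r'(1) r] by blast
      qed
    qed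
    show "K \<delta> \<inter> K \<epsilon> = {}" if de: "\<delta> \<in> ?D" "\<epsilon> \<in> ?D" "\<delta> \<noteq> \<epsilon>" for \<delta> \<epsilon>
    proof -
      obtain x y where xy: "x \<in> C" "y \<in> C" "\<delta> = prepend_one x" "\<epsilon> = prepend_one y" "x \<noteq> y"
        using de by blast
      have far: "\<exists>k. k \<noteq> i \<and> k \<noteq> j \<and> \<delta> k \<noteq> \<epsilon> k" for i j
      proof -
        \<comment> \<open>Coordinate \<open>k\<close> of \<open>x\<close> is coordinate
          \<open>Suc k\<close> of \<open>prepend_one x\<close>, hence the predecessors; for
          \<open>i = 0\<close> the inequality \<open>Suc k \<noteq> i\<close> holds anyway.\<close>
        obtain k where "k \<noteq> i - 1" "k \<noteq> j - 1" "x k \<noteq> y k"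
          using one_code_differ_outside_pair[OF C xy(1,2,5)] by metis
        then show ?thesis by (intro exI[of _ "Suc k"]) (auto simp: xy prepend_one_def)
      qed
      have "\<delta> 0 = \<epsilon> 0" "\<delta> 0 \<noteq> 0" by (simp_all add: xy prepend_one_def)
      then show ?thesis
        using components_disjoint[OF D[OF de(1)] D[OF de(2)] _ _ de(3) far] by (auto simp: K_def)
    qed
  qed
  moreover have "(\<lambda>x. x + unit_vec \<delta>) ` K \<delta> = (\<lambda>r. r + pad m \<delta>) ` linear_component m \<delta>" for \<delta>
    by (simp add: K_def image_comp comp_def)
  ultimately show ?thesis by (simp add: switched_code_def K_def)
qed

theorem theorem1:
  fixes m :: nat and C :: "(nat \<Rightarrow> 'a::{field,finite}) set"
  assumes "m \<ge> 2"
    and "one_code {..<m - 1} C"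
  shows "one_perfect (normalized m) (switched_code m C) \<and>
    C = {x \<in> vecs {..<m - 1}. pad m (prepend_one x) \<in> switched_code m C}"
proof
  have m: "m \<ge> 1" using assms(1) by simp
  have C: "x \<in> vecs {..<m - 1}" if "x \<in> C" for x
    using assms(2) that by (auto simp: one_code_def)
  have vec: "prepend_one x \<in> vecs {..<m} \<and> prepend_one x \<noteq> 0"
    if "x \<in> vecs {..<m - 1}" for x :: "nat \<Rightarrow> 'a"
    using prepend_one_in_normalized[OF m that] by (simp add: normalized_def)
  show "one_perfect (normalized m) (switched_code m C)"
    using m assms(2) by (rule one_perfect_switched_code)
  show "C = {x \<in> vecs {..<m - 1}. pad m (prepend_one x) \<in> switched_code m C}"
  proof (intro equalityI subsetI CollectI conjI)
    fix x assume x: "x \<in> C"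
    show "x \<in> vecs {..<m - 1}" using C x .
    have "pad m (prepend_one x) = 0 + pad m (prepend_one x)" by simp
    then show "pad m (prepend_one x) \<in> switched_code m C"
      unfolding switched_code_def using x vs.subspace_0[OF linear_component_subspace] by blast
  next
    fix x assume "x \<in> {x \<in> vecs {..<m - 1}. pad m (prepend_one x) \<in> switched_code m C}"
    then have x: "x \<in> vecs {..<m - 1}" "pad m (prepend_one x) \<in> switched_code m C" by auto
    \<comment> \<open>Its syndrome is the nonzero vector \<open>prepend_one x\<close>, so the word
      can only come from a switched-in piece.\<close>
    have "pad m (prepend_one x) \<notin> hamming_code m"
      using vec[OF x(1)] by (auto simp: hamming_code_eq syndrome_pad)
    then obtain y r where y: "y \<in> C" "r \<in> linear_component m (prepend_one y)"
        "pad m (prepend_one x) = r + pad m (prepend_one y)"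
      using x(2) unfolding switched_code_def by blast
    \<comment> \<open>Words of the component have syndrome 0, so comparing syndromes identifies
      \<open>prepend_one x\<close> with \<open>prepend_one y\<close>.\<close>
    have "partial_syndrome m UNIV r = 0"
      using y(2) linear_component_subset_hamming_code by (auto simp: hamming_code_eq)
    then have "prepend_one x = prepend_one y"
      using arg_cong[OF y(3), of "partial_syndrome m UNIV"] vec[OF x(1)] vec[OF C[OF y(1)]]
      by (simp add: partial_syndrome_add syndrome_pad)
    then have "prepend_one x (Suc k) = prepend_one y (Suc k)" for k by (rule fun_cong)
    then have "x k = y k" for k by (simp add: prepend_one_def)
    then show "x \<in> C" using y(1) by (metis ext)
  qed
qed

end
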